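(* Let $A$ be a real symmetric positive definite $n\times n$ matrix with energy decomposition $\mathcal{E}$, $\mathcal{V}$ an orthonormal basis of $\mathbb{R}^n$, $\mathcal{P}=\{P_j\}_{j=1}^M$ a partition of $\mathcal{V}$, and let $\Phi=[\Phi_1,\dots,\Phi_M]$ be an $n\times N$ matrix, where the columns of $\Phi_j$ form an orthonormal basis of a subspace of $\mathrm{span}\{P_j\}$. Let $\Psi=A^{-1}\Phi(\Phi^TA^{-1}\Phi)^{-1}$ and $A_{\mathrm{st}}=\Psi^TA\Psi$. Let $\lambda_{\min}(A_{\mathrm{st}})$ and $\lambda_{\max}(A_{\mathrm{st}})$ denote the smallest and largest eigenvalues of $A_{\mathrm{st}}$. Then $$\lambda_{\min}(A_{\mathrm{st}})\ge\lambda_{\min}(A),\qquad\lambda_{\max}(A_{\mathrm{st}})\le\delta(\mathcal{P}),$$ and so $$\kappa(A_{\mathrm{st}})=\frac{\lambda_{\max}(A_{\mathrm{st}})}{\lambda_{\min}(A_{\mathrm{st}})}\le\delta(\mathcal{P})\|A^{-1}\|_2.$$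
   Context: An energy decomposition of $A$ is a finite family $\mathcal{E}=\{E_k\}_{k=1}^m$ of symmetric positive semidefinite $n\times n$ matrices with $A=\sum_{k=1}^m E_k$. For $E\in\mathcal{E}$ and $v\in\mathcal{V}$ write $E\sim v$ if $v^TEv>0$. Let $\mathcal{N}(E;\mathcal{V})=\{v\in\mathcal{V}:E\sim v\}$. For $\mathcal{S}\subset\mathcal{V}$ write $E\sim\mathcal{S}$ if $\mathcal{N}(E;\mathcal{V})\cap\mathcal{S}\neq\emptyset$, and $E\in\mathcal{S}$ if $\mathcal{N}(E;\mathcal{V})\subset\mathcal{S}$. Let $P_{\mathcal{S}}$ be the Euclidean orthogonal projection onto $\mathrm{span}\{\mathcal{S}\}$. The closed energy of $\mathcal{S}$ is $\overline{A}_{\mathcal{S}}=\sum_{E\in\mathcal{S}}E+\sum_{E\notin\mathcal{S},\,E\sim\mathcal{S}}P_{\mathcal{S}}E^{d}P_{\mathcal{S}}$, where $E^{d}=\sum_{v\in\mathcal{V}}\big(\sum_{u\in\mathcal{V}}|v^TEu|\big)vv^T$; it maps $\mathrm{span}\{\mathcal{S}\}$ to itself and is invertible there. A partition of $\mathcal{V}$ is a family of pairwise disjoint subsets $P_j\subset\mathcal{V}$ (patches) with union $\mathcal{V}$. Condition factor: $\delta(P_j)=\max_{0\ne x\in\mathrm{span}(\Phi_j)}\frac{x^Tx}{x^T\overline{A}_{P_j}^{-1}x}$ (set to $0$ if $\Phi_j$ is empty), where $\overline{A}_{P_j}^{-1}$ is the inverse of $\overline{A}_{P_j}$ as an operator on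 $\mathrm{span}\{P_j\}$; $\delta(\mathcal{P})=\max_j\delta(P_j)$. $\|\cdot\|_2$ is the spectral norm. *)

theory Defs
  imports "HOL-Analysis.Analysis"
begin

definition psd_matrix :: "real^'n^'n \<Rightarrow> bool" where
  "psd_matrix B \<longleftrightarrow> transpose B = B \<and> (\<forall>x. 0 \<le> x \<bullet> (B *v x))"

definition spd_matrix :: "real^'n^'n \<Rightarrow> bool" where
  "spd_matrix B \<longleftrightarrow> transpose B = B \<and> (\<forall>x. x \<noteq> 0 \<longrightarrow> 0 < x \<bullet> (B *v x))"

definition matrix_eigenvalue :: "real^'n^'n \<Rightarrow> real \<Rightarrow> bool" where
  "matrix_eigenvalue B \<mu> \<longleftrightarrow> (\<exists>x. x \<noteq> 0 \<and> B *v x = \<mu> *\<^sub>R x)"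

definition lambda_min :: "real^'n^'n \<Rightarrow> real" where
  "lambda_min B = Min {\<mu>. matrix_eigenvalue B \<mu>}"

definition lambda_max :: "real^'n^'n \<Rightarrow> real" where
  "lambda_max B = Max {\<mu>. matrix_eigenvalue B \<mu>}"

definition spectral_norm :: "real^'n^'m \<Rightarrow> real" where
  "spectral_norm B = onorm (\<lambda>x. B *v x)"

definition condition_number :: "real^'n^'n \<Rightarrow> real" where
  "condition_number B = spectral_norm B * spectral_norm (matrix_inv B)"

text \<open>The family is indexed, so that the columns of a matrix can be required to be
  orthonormal, hence pairwise distinct. The empty family is an orthonormal basis of the zero
  subspace.\<close>
definition orthonormal_basis_on :: "'i set \<Rightarrow> ('i \<Rightarrow> 'a::euclidean_space) \<Rightarrow> 'a set \<Rightarrow> bool" where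
  "orthonormal_basis_on I f W \<longleftrightarrow>
     (\<forall>i\<in>I. \<forall>k\<in>I. f i \<bullet> f k = (if i = k then 1 else 0)) \<and> span (f ` I) = W"

definition orth_proj :: "'a::euclidean_space set \<Rightarrow> 'a \<Rightarrow> 'a" where
  "orth_proj W x = (THE y. y \<in> W \<and> (\<forall>w\<in>W. orthogonal (x - y) w))"

definition proj_matrix :: "(real^'n) set \<Rightarrow> real^'n^'n" where
  "proj_matrix S = matrix (orth_proj (span S))"

definition outer_product :: "real^'n \<Rightarrow> real^'n^'n" where
  "outer_product v = (columnvector v :: real^1^'n) ** (rowvector v :: real^'n^1)"

text \<open>The energies are a family \<open>E 1, \<dots>, E m\<close>; repetitions are counted with multiplicity.\<close>
definition energy_decomposition :: "real^'n^'n \<Rightarrow> nat \<Rightarrow> (nat \<Rightarrow> real^'n^'n) \<Rightarrow> bool" where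
  "energy_decomposition A m E \<longleftrightarrow>
     (\<forall>k\<in>{1..m}. psd_matrix (E k)) \<and> A = (\<Sum>k=1..m. E k)"

definition energy_nbhd :: "(real^'n) set \<Rightarrow> real^'n^'n \<Rightarrow> (real^'n) set" where
  "energy_nbhd V B = {v \<in> V. v \<bullet> (B *v v) > 0}"

text \<open>\<open>energy_touches\<close> is the relation written \<open>E \<sim> S\<close> and \<open>energy_inside\<close> the one written
  \<open>E \<in> S\<close>.\<close>
definition energy_touches :: "(real^'n) set \<Rightarrow> real^'n^'n \<Rightarrow> (real^'n) set \<Rightarrow> bool" where
  "energy_touches V B S \<longleftrightarrow> energy_nbhd V B \<inter> S \<noteq> {}"

definition energy_inside :: "(real^'n) set \<Rightarrow> real^'n^'n \<Rightarrow> (real^'n) set \<Rightarrow> bool" where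
  "energy_inside V B S \<longleftrightarrow> energy_nbhd V B \<subseteq> S"

definition energy_diag :: "(real^'n) set \<Rightarrow> real^'n^'n \<Rightarrow> real^'n^'n" where
  "energy_diag V B = (\<Sum>v\<in>V. (\<Sum>u\<in>V. \<bar>v \<bullet> (B *v u)\<bar>) *\<^sub>R outer_product v)"

definition closed_energy ::
  "nat \<Rightarrow> (nat \<Rightarrow> real^'n^'n) \<Rightarrow> (real^'n) set \<Rightarrow> (real^'n) set \<Rightarrow> real^'n^'n" where
  "closed_energy m E V S =
     (\<Sum>k | k \<in> {1..m} \<and> energy_inside V (E k) S. E k) +
     (\<Sum>k | k \<in> {1..m} \<and> \<not> energy_inside V (E k) S \<and> energy_touches V (E k) S.
        proj_matrix S ** energy_diag V (E k) ** proj_matrix S)"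

text \<open>The inverse of the operator restricted to \<open>span S\<close>; the matrix itself is singular in general.
  Only its values on \<open>span S\<close> are meaningful.\<close>
definition closed_energy_inv ::
  "nat \<Rightarrow> (nat \<Rightarrow> real^'n^'n) \<Rightarrow> (real^'n) set \<Rightarrow> (real^'n) set \<Rightarrow> real^'n \<Rightarrow> real^'n" where
  "closed_energy_inv m E V S = inv_into (span S) (\<lambda>x. closed_energy m E V S *v x)"

definition indexed_partition :: "'a set \<Rightarrow> nat \<Rightarrow> (nat \<Rightarrow> 'a set) \<Rightarrow> bool" where
  "indexed_partition V M P \<longleftrightarrow> disjoint_family_on P {1..M} \<and> (\<Union>j\<in>{1..M}. P j) = V"

text \<open>A block structure \<open>\<Phi> = [\<Phi>\<^sub>1, \<dots>, \<Phi>\<^sub>M]\<close> is a map \<open>blk\<close> sending each column index to the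
  number of the block containing that column.\<close>
definition block_columns :: "real^'c^'n \<Rightarrow> ('c \<Rightarrow> nat) \<Rightarrow> nat \<Rightarrow> (real^'n) set" where
  "block_columns \<Phi> blk j = (\<lambda>c. column c \<Phi>) ` {c. blk c = j}"

text \<open>\<open>F\<close> is the set of columns of the block belonging to the patch \<open>S\<close>. The greatest value
  exists when the closed energy is positive definite on \<open>span S\<close> and \<open>F \<subseteq> span S\<close> has nonzero span:
  the quotient is continuous and invariant under scaling.\<close>
definition patch_condition_factor ::
  "nat \<Rightarrow> (nat \<Rightarrow> real^'n^'n) \<Rightarrow> (real^'n) set \<Rightarrow> (real^'n) set \<Rightarrow> (real^'n) set \<Rightarrow> real" where
  "patch_condition_factor m E V S F =
     (if F = {} then 0
      else (GREATEST r. \<exists>x. x \<in> span F \<and> x \<noteq> 0 \<and>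
                r = (x \<bullet> x) / (x \<bullet> closed_energy_inv m E V S x)))"

definition condition_factor ::
  "nat \<Rightarrow> (nat \<Rightarrow> real^'n^'n) \<Rightarrow> (real^'n) set \<Rightarrow> nat \<Rightarrow> (nat \<Rightarrow> (real^'n) set) \<Rightarrow>
     real^'c^'n \<Rightarrow> ('c \<Rightarrow> nat) \<Rightarrow> real" where
  "condition_factor m E V M P \<Phi> blk =
     Max ((\<lambda>j. patch_condition_factor m E V (P j) (block_columns \<Phi> blk j)) ` {1..M})"

definition basis_Psi :: "real^'n^'n \<Rightarrow> real^'c^'n \<Rightarrow> real^'c^'n" where
  "basis_Psi A \<Phi> = matrix_inv A ** \<Phi> ** matrix_inv (transpose \<Phi> ** matrix_inv A ** \<Phi>)"

definition stiffness_matrix :: "real^'n^'n \<Rightarrow> real^'c^'n \<Rightarrow> real^'c^'c" where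
  "stiffness_matrix A \<Phi> = transpose (basis_Psi A \<Phi>) ** A ** basis_Psi A \<Phi>"

end

theory Submission
  imports Defs
begin

text \<open>Because distinct patches are orthogonal, \<open>\<Phi>\<close> is an isometry, and the stiffness matrix is
  the inverse of the Gram matrix \<open>G = \<Phi>\<^sup>T A\<^sup>-\<^sup>1 \<Phi>\<close> (\<open>stiffness_eq_gram_inverse\<close>). Upper and lower
  bounds for the Rayleigh quotients of \<open>G\<close> therefore become lower and upper bounds for the
  eigenvalues of the stiffness matrix. The upper bound \<open>1 / \<lambda>\<^sub>m\<^sub>i\<^sub>n(A)\<close> is the one for \<open>A\<^sup>-\<^sup>1\<close>, of which
  \<open>G\<close> is a compression.

  The lower bound \<open>1 / \<delta>(\<P>)\<close> comes from decoupling the patches. For \<open>z = \<Sum>\<^sub>j z\<^sub>j\<close> with \<open>z\<^sub>j\<close> in the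
  span of \<open>P\<^sub>j\<close>, the form of \<open>A\<close> at \<open>z\<close> is at most the sum of the closed energies at the \<open>z\<^sub>j\<close>
  (\<open>energy_le_closed_energies\<close>). Indeed an energy inside one patch contributes the same to both
  sides, and any other energy is dominated by its diagonal part, which has no terms coupling
  different basis vectors. Legendre duality reverses the inequality between the inverses: for
  \<open>y = \<Sum>\<^sub>j y\<^sub>j\<close> the form of \<open>A\<^sup>-\<^sup>1\<close> is at least the sum of the forms of the inverse closed energies
  (\<open>closed_energy_inverses_le\<close>). By definition of the condition factor each of these is at least
  \<open>|y\<^sub>j|\<^sup>2 / \<delta>(\<P>)\<close>, and the squared norms add up to that of \<open>y\<close>.

  The extreme eigenvalues of a symmetric matrix are treated through Rayleigh quotients. The
  Cauchy-Schwarz inequality for a positive semidefinite form gives both the eigenvector equation at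
  a maximizer and the equality of the spectral norm with the largest eigenvalue; its consequence
  \<open>psd_kernel\<close> also shows that an energy annihilates the basis vectors outside its
  neighbourhood.\<close>

section \<open>Symmetric matrices and their extreme eigenvalues\<close>

lemma transpose_inner:
  fixes B :: "real^'c^'n"
  shows "x \<bullet> (B *v y) = (transpose B *v x) \<bullet> y"
  by (metis dot_lmul_matrix transpose_transpose vector_transpose_matrix)

lemma symmetric_inner:
  fixes B :: "real^'n^'n"
  assumes "transpose B = B"
  shows "x \<bullet> (B *v y) = (B *v x) \<bullet> y"
  using transpose_inner[of x B y] assms by simp

text \<open>The form is nonnegative at \<open>s x + t y\<close>; the choice \<open>s = y \<bullet> B y\<close>, \<open>t = - x \<bullet> B y\<close> turns this
  into \<open>y \<bullet> B y\<close> times the asserted inequality.\<close>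
lemma psd_cauchy_schwarz:
  assumes "psd_matrix B"
  shows "(x \<bullet> (B *v y))\<^sup>2 \<le> (x \<bullet> (B *v x)) * (y \<bullet> (B *v y))"
proof -
  let ?a = "x \<bullet> (B *v x)" and ?b = "x \<bullet> (B *v y)" and ?c = "y \<bullet> (B *v y)"
  have sym: "y \<bullet> (B *v x) = ?b"
    using symmetric_inner assms by (metis psd_matrix_def inner_commute)
  have expand: "0 \<le> s^2 * ?a + 2 * (s * t) * ?b + t^2 * ?c" for s t
  proof -
    have "0 \<le> (s *\<^sub>R x + t *\<^sub>R y) \<bullet> (B *v (s *\<^sub>R x + t *\<^sub>R y))"
      using assms by (simp add: psd_matrix_def)
    then show ?thesis
      by (simp add: matrix_vector_right_distrib matrix_vector_mult_scaleR inner_add_left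
          inner_add_right sym power2_eq_square algebra_simps)
  qed
  have nonneg: "0 \<le> ?a" "0 \<le> ?c" using assms by (simp_all add: psd_matrix_def)
  show ?thesis
  proof (cases "?c = 0")
    case True
    \<comment> \<open>For \<open>s = 1\<close> the quadratic in \<open>t\<close> degenerates to an affine function bounded below; at the
       chosen \<open>t\<close> it would take the value \<open>-1\<close>.\<close>
    have "?b = 0"
    proof (rule ccontr)
      assume b: "?b \<noteq> 0"
      have "0 \<le> ?a + 2 * (- (?a + 1) / (2 * ?b)) * ?b"
        using expand[of 1 "- (?a + 1) / (2 * ?b)"] True by simp
      then show False using b by (simp add: field_simps)
    qed
    then show ?thesis using True by simp
  next
    case False
    have "0 \<le> ?c * (?a * ?c - ?b\<^sup>2)"
      using expand[of ?c "- ?b"] by (simp add: power2_eq_square algebra_simps)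
    then show ?thesis using False nonneg by (simp add: zero_le_mult_iff)
  qed
qed

text \<open>Cauchy-Schwarz for the pair \<open>B x, x\<close> bounds \<open>|B x|\<^sup>4\<close> by a multiple of \<open>x \<bullet> B x\<close>.\<close>
lemma psd_kernel:
  assumes "psd_matrix B" "x \<bullet> (B *v x) = 0"
  shows "B *v x = 0"
proof -
  have "((B *v x) \<bullet> (B *v x))\<^sup>2 \<le> 0"
    using psd_cauchy_schwarz[OF assms(1), of "B *v x" x] assms(2) by simp
  then show ?thesis by simp
qed

lemma spd_imp_psd: "spd_matrix B \<Longrightarrow> psd_matrix B"
  unfolding spd_matrix_def psd_matrix_def by (metis inner_zero_left less_eq_real_def)

text \<open>Eigenvectors for distinct eigenvalues are orthogonal, so there are at most \<open>n\<close> of them.\<close>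
lemma symmetric_finite_eigenvalues:
  fixes B :: "real^'n^'n"
  assumes "transpose B = B"
  shows "finite {\<mu>. matrix_eigenvalue B \<mu>}"
proof -
  let ?L = "{\<mu>. matrix_eigenvalue B \<mu>}"
  define e where "e = (\<lambda>\<mu>. SOME x. x \<noteq> 0 \<and> B *v x = \<mu> *\<^sub>R x)"
  have e: "e \<mu> \<noteq> 0 \<and> B *v e \<mu> = \<mu> *\<^sub>R e \<mu>" if "\<mu> \<in> ?L" for \<mu>
    using that unfolding e_def mem_Collect_eq matrix_eigenvalue_def by (rule someI_ex)
  have orth: "e \<mu> \<bullet> e \<nu> = 0" if "\<mu> \<in> ?L" "\<nu> \<in> ?L" "\<mu> \<noteq> \<nu>" for \<mu> \<nu>
  proof -
    have "\<nu> * (e \<mu> \<bullet> e \<nu>) = \<mu> * (e \<mu> \<bullet> e \<nu>)"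
      using symmetric_inner[OF assms, of "e \<mu>" "e \<nu>"] e[OF that(1)] e[OF that(2)] by simp
    then show ?thesis using that(3) by simp
  qed
  have inj: "inj_on e ?L"
  proof (rule inj_onI, rule ccontr)
    fix \<mu> \<nu> assume *: "\<mu> \<in> ?L" "\<nu> \<in> ?L" "e \<mu> = e \<nu>" "\<mu> \<noteq> \<nu>"
    with orth[of \<mu> \<nu>] e[of \<nu>] show False by simp
  qed
  have "pairwise orthogonal (e ` ?L)"
    using orth by (auto simp: pairwise_def orthogonal_def)
  moreover have "0 \<notin> e ` ?L" using e by auto
  ultimately have "finite (e ` ?L)"
    using pairwise_orthogonal_independent independent_imp_finite by blast
  then show ?thesis using inj by (rule finite_imageD)
qed

text \<open>At a maximizer \<open>x\<close> of the Rayleigh quotient, with value \<open>\<mu>\<close>, the positive semidefinite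
  form of \<open>\<mu> I - B\<close> vanishes; its kernel then contains \<open>x\<close>, so \<open>x\<close> is an eigenvector.\<close>
lemma symmetric_rayleigh_max:
  fixes B :: "real^'n^'n"
  assumes "transpose B = B"
  obtains \<mu> where "matrix_eigenvalue B \<mu>" "\<And>x. x \<bullet> (B *v x) \<le> \<mu> * (x \<bullet> x)"
proof -
  have "continuous_on (sphere 0 1) (\<lambda>x::real^'n. x \<bullet> (B *v x))"
    by (intro continuous_intros linear_continuous_on) auto
  moreover have "sphere (0::real^'n) 1 \<noteq> {}" by simp
  ultimately obtain u where u: "norm u = 1"
    and max: "\<And>y. norm y = 1 \<Longrightarrow> y \<bullet> (B *v y) \<le> u \<bullet> (B *v u)"
    using continuous_attains_sup[OF compact_sphere, of "0::real^'n" 1 "\<lambda>x. x \<bullet> (B *v x)"] by auto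
  define \<mu> where "\<mu> = u \<bullet> (B *v u)"
  have bound: "x \<bullet> (B *v x) \<le> \<mu> * (x \<bullet> x)" for x
  proof (cases "x = 0")
    case False
    have "(x /\<^sub>R norm x) \<bullet> (B *v (x /\<^sub>R norm x)) \<le> \<mu>"
      unfolding \<mu>_def using False by (intro max) simp
    then have "x \<bullet> (B *v x) / (norm x)\<^sup>2 \<le> \<mu>"
      by (simp add: matrix_vector_mult_scaleR power2_eq_square field_simps)
    then show ?thesis using False by (simp add: power2_norm_eq_inner field_simps)
  qed simp
  let ?C = "\<mu> *\<^sub>R mat 1 - B"
  have C: "?C *v x = \<mu> *\<^sub>R x - B *v x" for x
    by (simp add: matrix_vector_mult_diff_rdistrib flip: scaleR_matrix_vector_assoc)
  have "transpose ?C = ?C"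
    using assms by (simp add: transpose_def mat_def vec_eq_iff)
  then have "psd_matrix ?C"
    using bound by (simp add: psd_matrix_def C inner_diff_right)
  moreover have "u \<bullet> (?C *v u) = 0"
    using u by (simp add: C inner_diff_right norm_eq_1 flip: \<mu>_def)
  ultimately have "B *v u = \<mu> *\<^sub>R u"
    using psd_kernel[of ?C u] C[of u] by simp
  then have "matrix_eigenvalue B \<mu>"
    using u unfolding matrix_eigenvalue_def by (intro exI[of _ u]) auto
  then show thesis using bound that by blast
qed

lemma eigenvalue_rayleigh_le:
  assumes "matrix_eigenvalue B \<mu>" "\<And>x. x \<bullet> (B *v x) \<le> K * (x \<bullet> x)"
  shows "\<mu> \<le> K"
proof -
  obtain x where x: "x \<noteq> 0" "B *v x = \<mu> *\<^sub>R x"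
    using assms(1) unfolding matrix_eigenvalue_def by blast
  then show ?thesis using assms(2)[of x] by simp
qed

lemma symmetric_lambda_max:
  fixes B :: "real^'n^'n"
  assumes "transpose B = B"
  shows "matrix_eigenvalue B (lambda_max B)"
    and "x \<bullet> (B *v x) \<le> lambda_max B * (x \<bullet> x)"
proof -
  obtain \<mu> where \<mu>: "matrix_eigenvalue B \<mu>" "\<And>x. x \<bullet> (B *v x) \<le> \<mu> * (x \<bullet> x)"
    using symmetric_rayleigh_max[OF assms] by blast
  have "lambda_max B = \<mu>"
    unfolding lambda_max_def
    using symmetric_finite_eigenvalues[OF assms] \<mu> eigenvalue_rayleigh_le
    by (intro Max_eqI) blast+
  then show "matrix_eigenvalue B (lambda_max B)" "x \<bullet> (B *v x) \<le> lambda_max B * (x \<bullet> x)"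
    using \<mu> by simp_all
qed

lemma symmetric_lambda_min:
  fixes B :: "real^'n^'n"
  assumes "transpose B = B"
  shows "matrix_eigenvalue B (lambda_min B)"
    and "matrix_eigenvalue B \<mu> \<Longrightarrow> lambda_min B \<le> \<mu>"
proof -
  let ?L = "{\<mu>. matrix_eigenvalue B \<mu>}"
  have fin: "finite ?L" by (rule symmetric_finite_eigenvalues[OF assms])
  have "?L \<noteq> {}" using symmetric_lambda_max(1)[OF assms] by blast
  then show "matrix_eigenvalue B (lambda_min B)"
    using Min_in[OF fin] unfolding lambda_min_def by blast
  show "matrix_eigenvalue B \<mu> \<Longrightarrow> lambda_min B \<le> \<mu>"
    unfolding lambda_min_def using Min_le[OF fin] by blast
qed

text \<open>With \<open>y = B x\<close>, Cauchy-Schwarz gives \<open>|y|\<^sup>4 \<le> (y \<bullet> B y) (x \<bullet> B x) \<le> \<mu>\<^sup>2 |y|\<^sup>2 |x|\<^sup>2\<close> for the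
  largest eigenvalue \<open>\<mu>\<close>.\<close>
lemma psd_spectral_norm:
  assumes "psd_matrix B"
  shows "spectral_norm B = lambda_max B"
proof -
  have sym: "transpose B = B" using assms by (simp add: psd_matrix_def)
  let ?\<mu> = "lambda_max B"
  obtain u where u: "u \<noteq> 0" "B *v u = ?\<mu> *\<^sub>R u"
    using symmetric_lambda_max(1)[OF sym] unfolding matrix_eigenvalue_def by blast
  have "0 \<le> u \<bullet> (B *v u)" using assms by (simp add: psd_matrix_def)
  moreover have "0 < u \<bullet> u" using u(1) by simp
  ultimately have nonneg: "0 \<le> ?\<mu>" using u(2) by (simp add: zero_le_mult_iff)
  have "norm (B *v x) \<le> ?\<mu> * norm x" for x
  proof -
    let ?y = "B *v x"
    have "(?y \<bullet> ?y)\<^sup>2 \<le> (?y \<bullet> (B *v ?y)) * (x \<bullet> (B *v x))"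
      by (rule psd_cauchy_schwarz[OF assms])
    also have "\<dots> \<le> (?\<mu> * (?y \<bullet> ?y)) * (?\<mu> * (x \<bullet> x))"
      using assms nonneg
      by (intro mult_mono symmetric_lambda_max(2)[OF sym]) (auto simp: psd_matrix_def)
    finally have "(norm ?y)^2 * (norm ?y)^2 \<le> (norm ?y)^2 * (?\<mu> * norm x)^2"
      unfolding dot_square_norm by (simp add: power2_eq_square mult_ac)
    then have "norm ?y = 0 \<or> (norm ?y)^2 \<le> (?\<mu> * norm x)^2"
      by (metis mult_le_cancel_left_pos zero_less_norm_iff zero_less_power norm_eq_zero)
    then show ?thesis
      using nonneg by (auto intro: power2_le_imp_le)
  qed
  then have "spectral_norm B \<le> ?\<mu>"
    unfolding spectral_norm_def by (rule onorm_le)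
  moreover have "?\<mu> * norm u \<le> spectral_norm B * norm u"
    using onorm[OF matrix_vector_mul_bounded_linear, of B u] u nonneg
    by (simp add: spectral_norm_def)
  then have "?\<mu> \<le> spectral_norm B" using u(1) by simp
  ultimately show ?thesis by simp
qed

section \<open>Inverses of positive definite matrices\<close>

lemma matrix_inv_eqI:
  fixes B C :: "real^'n^'n"
  assumes "B ** C = mat 1"
  shows "matrix_inv B = C"
proof -
  have CB: "C ** B = mat 1" using assms by (simp add: matrix_left_right_inverse)
  have "B ** matrix_inv B = mat 1 \<and> matrix_inv B ** B = mat 1"
    unfolding matrix_inv_def by (rule someI[of _ C]) (simp add: assms CB)
  then show ?thesis by (metis CB matrix_mul_assoc matrix_mul_lid matrix_mul_rid)
qed

lemma spd_matrix_inv: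
  assumes "spd_matrix B"
  shows "B ** matrix_inv B = mat 1" and "matrix_inv B ** B = mat 1"
proof -
  have "B *v x = 0 \<longrightarrow> x = 0" for x
    using assms unfolding spd_matrix_def by (metis inner_zero_right less_irrefl)
  then obtain C where "C ** B = mat 1"
    using matrix_left_invertible_ker[of B] by blast
  then have "B ** C = mat 1" by (simp add: matrix_left_right_inverse)
  moreover from this have "matrix_inv B = C" by (rule matrix_inv_eqI)
  ultimately show "B ** matrix_inv B = mat 1" "matrix_inv B ** B = mat 1"
    using \<open>C ** B = mat 1\<close> by simp_all
qed

lemma matrix_inv_matrix_inv:
  assumes "spd_matrix B"
  shows "matrix_inv (matrix_inv B) = B"
  using spd_matrix_inv(2)[OF assms] by (rule matrix_inv_eqI)

lemma spd_matrix_inv_vector: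
  assumes "spd_matrix B"
  shows "B *v (matrix_inv B *v x) = x" and "matrix_inv B *v (B *v x) = x"
  using spd_matrix_inv[OF assms] by (simp_all add: matrix_vector_mul_assoc)

lemma spd_inverse:
  assumes "spd_matrix B"
  shows "spd_matrix (matrix_inv B)"
proof -
  let ?C = "matrix_inv B"
  note inv = spd_matrix_inv[OF assms]
  have sym: "transpose B = B" using assms by (simp add: spd_matrix_def)
  have "B ** transpose ?C = mat 1"
    using inv(2) sym by (metis matrix_transpose_mul transpose_mat)
  then have "transpose ?C = ?C" using matrix_inv_eqI by metis
  moreover have "0 < x \<bullet> (?C *v x)" if "x \<noteq> 0" for x
  proof -
    have B: "B *v (?C *v x) = x" by (rule spd_matrix_inv_vector[OF assms])
    then have "?C *v x \<noteq> 0" using that by auto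
    then have "0 < (?C *v x) \<bullet> (B *v (?C *v x))" using assms by (simp add: spd_matrix_def)
    then show ?thesis by (simp only: B inner_commute)
  qed
  ultimately show ?thesis by (simp add: spd_matrix_def)
qed

lemma spd_eigenvalue_pos:
  assumes "spd_matrix B" "matrix_eigenvalue B \<mu>"
  shows "0 < \<mu>"
proof -
  obtain x where x: "x \<noteq> 0" "B *v x = \<mu> *\<^sub>R x"
    using assms(2) unfolding matrix_eigenvalue_def by blast
  then have "0 < x \<bullet> (\<mu> *\<^sub>R x)" using assms(1) unfolding spd_matrix_def by metis
  moreover have "0 < x \<bullet> x" using x(1) by simp
  ultimately show ?thesis by (simp add: zero_less_mult_iff)
qed

lemma spd_inverse_eigenvalue:
  assumes "spd_matrix B" "matrix_eigenvalue B \<mu>"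
  shows "matrix_eigenvalue (matrix_inv B) (1 / \<mu>)"
proof -
  obtain x where x: "x \<noteq> 0" "B *v x = \<mu> *\<^sub>R x"
    using assms(2) unfolding matrix_eigenvalue_def by blast
  have "matrix_inv B *v (\<mu> *\<^sub>R x) = x" using spd_matrix_inv_vector(2)[OF assms(1), of x] x by simp
  then have "\<mu> *\<^sub>R (matrix_inv B *v x) = x" by (simp add: matrix_vector_mult_scaleR)
  then have "matrix_inv B *v x = (1 / \<mu>) *\<^sub>R x"
    using spd_eigenvalue_pos[OF assms]
    by (metis divide_inverse_commute less_irrefl mult.right_neutral real_vector.scale_one
        scaleR_scaleR left_inverse)
  then show ?thesis using x unfolding matrix_eigenvalue_def by blast
qed

lemma spd_lambda_max_inverse:
  assumes "spd_matrix B"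
  shows "lambda_max (matrix_inv B) = 1 / lambda_min B"
proof (rule antisym)
  let ?C = "matrix_inv B"
  have symB: "transpose B = B" and symC: "transpose ?C = ?C"
    using assms spd_inverse[OF assms] by (simp_all add: spd_matrix_def)
  let ?M = "lambda_max ?C"
  have ev: "matrix_eigenvalue ?C ?M" by (rule symmetric_lambda_max(1)[OF symC])
  have "matrix_eigenvalue B (1 / ?M)"
    using spd_inverse_eigenvalue[OF spd_inverse[OF assms] ev] by (simp add: matrix_inv_matrix_inv assms)
  then have "lambda_min B \<le> 1 / ?M" by (rule symmetric_lambda_min(2)[OF symB])
  moreover have "0 < lambda_min B"
    using spd_eigenvalue_pos[OF assms symmetric_lambda_min(1)[OF symB]] .
  moreover have "0 < ?M" using spd_eigenvalue_pos[OF spd_inverse[OF assms] ev] .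
  ultimately show "?M \<le> 1 / lambda_min B" by (simp add: field_simps)
  have "matrix_eigenvalue ?C (1 / lambda_min B)"
    by (rule spd_inverse_eigenvalue[OF assms symmetric_lambda_min(1)[OF symB]])
  then show "1 / lambda_min B \<le> ?M"
    by (rule eigenvalue_rayleigh_le) (rule symmetric_lambda_max(2)[OF symC])
qed

lemma spd_condition_number:
  assumes "spd_matrix B"
  shows "condition_number B = lambda_max B / lambda_min B"
  using assms spd_inverse[OF assms]
  by (simp add: condition_number_def psd_spectral_norm spd_imp_psd spd_lambda_max_inverse)

text \<open>One half of Legendre duality for quadratic forms; the bound is attained at
  \<open>z = A\<^sup>-\<^sup>1 y\<close>.\<close>
lemma spd_inverse_form_ge:
  assumes "spd_matrix A"
  shows "2 * (y \<bullet> z) - z \<bullet> (A *v z) \<le> y \<bullet> (matrix_inv A *v y)"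
proof -
  let ?w = "matrix_inv A *v y"
  have Aw: "A *v ?w = y" by (rule spd_matrix_inv_vector[OF assms])
  have sym: "transpose A = A" using assms by (simp add: spd_matrix_def)
  have "0 \<le> (?w - z) \<bullet> (A *v (?w - z))"
    using spd_imp_psd[OF assms] by (simp add: psd_matrix_def)
  moreover have "?w \<bullet> (A *v z) = y \<bullet> z"
    using symmetric_inner[OF sym, of ?w z] Aw by simp
  ultimately show ?thesis
    by (simp add: matrix_vector_mult_diff_distrib inner_diff_left inner_diff_right Aw
        inner_commute[of _ y])
qed

section \<open>Patches of an orthonormal basis\<close>

lemma sum_matrix_vector_mult:
  fixes F :: "'k \<Rightarrow> real^'c^'n"
  shows "(\<Sum>k\<in>I. F k) *v x = (\<Sum>k\<in>I. F k *v x)"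
  by (induction I rule: infinite_finite_induct) (simp_all add: matrix_vector_mult_add_rdistrib)

lemma outer_product_vector: "outer_product v *v x = (v \<bullet> x) *\<^sub>R v"
  by (simp add: outer_product_def columnvector_def rowvector_def matrix_matrix_mult_def
      matrix_vector_mult_def inner_vec_def vec_eq_iff sum_distrib_left sum_distrib_right mult_ac)

locale vector_orthonormal_basis =
  fixes V :: "(real^'n) set"
  assumes onb: "orthonormal_basis_on V (\<lambda>v. v) UNIV"
begin

lemma basis_inner: "u \<in> V \<Longrightarrow> v \<in> V \<Longrightarrow> u \<bullet> v = (if u = v then 1 else 0)"
  using onb unfolding orthonormal_basis_on_def by blast

lemma span_basis: "span V = UNIV"
  using onb unfolding orthonormal_basis_on_def by simp

lemma pairwise_orthogonal_basis: "pairwise orthogonal V"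
  by (simp add: pairwise_def orthogonal_def basis_inner)

lemma finite_basis: "finite V"
proof (rule independent_imp_finite[OF pairwise_orthogonal_independent])
  show "pairwise orthogonal V" by (rule pairwise_orthogonal_basis)
  show "0 \<notin> V" using basis_inner[of 0 0] by auto
qed

lemma finite_patch: "S \<subseteq> V \<Longrightarrow> finite S"
  using finite_basis by (rule rev_finite_subset)

lemma span_expand:
  assumes "S \<subseteq> V" "x \<in> span S"
  shows "(\<Sum>v\<in>S. (x \<bullet> v) *\<^sub>R v) = x"
proof (rule orthonormal_basis_expand)
  show "pairwise orthogonal S"
    using pairwise_orthogonal_basis assms(1) by (rule pairwise_subset)
  show "norm v = 1" if "v \<in> S" for v
    using basis_inner[of v v] assms(1) that by (auto simp: norm_eq_1)
qed (use assms finite_patch in auto)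

lemma span_patch_iff:
  assumes "S \<subseteq> V"
  shows "x \<in> span S \<longleftrightarrow> (\<forall>v\<in>V - S. x \<bullet> v = 0)"
proof
  assume "x \<in> span S"
  show "\<forall>v\<in>V - S. x \<bullet> v = 0"
  proof
    fix v assume v: "v \<in> V - S"
    have "x \<bullet> v = (\<Sum>u\<in>S. (x \<bullet> u) *\<^sub>R u) \<bullet> v"
      using span_expand[OF assms \<open>x \<in> span S\<close>] by simp
    also have "\<dots> = (\<Sum>u\<in>S. (x \<bullet> u) * (u \<bullet> v))"
      by (simp add: inner_sum_left)
    also have "\<dots> = 0"
      using v by (intro sum.neutral) (auto simp: basis_inner subsetD[OF assms])
    finally show "x \<bullet> v = 0" .
  qed
next
  assume z: "\<forall>v\<in>V - S. x \<bullet> v = 0"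
  have "x = (\<Sum>v\<in>V. (x \<bullet> v) *\<^sub>R v)"
    using span_expand[of V x] span_basis by simp
  also have "\<dots> = (\<Sum>v\<in>S. (x \<bullet> v) *\<^sub>R v)"
    using z assms finite_basis by (intro sum.mono_neutral_right) auto
  also have "\<dots> \<in> span S" by (intro span_sum span_scale span_base)
  finally show "x \<in> span S" .
qed

lemma inner_span_disjoint:
  assumes "S \<subseteq> V" "T \<subseteq> V" "S \<inter> T = {}" "x \<in> span S" "y \<in> span T"
  shows "x \<bullet> y = 0"
proof -
  have "v \<bullet> y = 0" if "v \<in> S" for v
    using assms that span_patch_iff[of T y] by (metis DiffI disjoint_iff inner_commute subsetD)
  then have "(\<Sum>v\<in>S. (x \<bullet> v) *\<^sub>R v) \<bullet> y = 0"
    by (simp add: inner_sum_left)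
  then show ?thesis using span_expand[OF assms(1,4)] by simp
qed

lemma orth_proj_patch:
  assumes "S \<subseteq> V"
  shows "orth_proj (span S) x = (\<Sum>v\<in>S. (x \<bullet> v) *\<^sub>R v)"
proof -
  let ?p = "\<Sum>v\<in>S. (x \<bullet> v) *\<^sub>R v"
  have p: "?p \<in> span S" by (intro span_sum span_scale span_base)
  have "(x - ?p) \<bullet> v = 0" if "v \<in> S" for v
  proof -
    have "?p \<bullet> v = (\<Sum>u\<in>S. if u = v then x \<bullet> u else 0)"
      unfolding inner_sum_left using that assms by (intro sum.cong) (auto simp: basis_inner subset_iff)
    then show ?thesis using that finite_patch[OF assms] by (simp add: inner_diff_left)
  qed
  then have o: "orthogonal (x - ?p) w" if "w \<in> span S" for w
    using orthogonal_to_span[OF that, of "x - ?p"] by (simp add: orthogonal_def)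
  show ?thesis
    unfolding orth_proj_def
  proof (rule the_equality)
    fix y assume y: "y \<in> span S \<and> (\<forall>w\<in>span S. orthogonal (x - y) w)"
    have d: "y - ?p \<in> span S" using y p by (simp add: span_diff)
    then have "(x - ?p) \<bullet> (y - ?p) = 0" "(x - y) \<bullet> (y - ?p) = 0"
      using o y unfolding orthogonal_def by blast+
    then have "((x - ?p) - (x - y)) \<bullet> (y - ?p) = 0" by (simp only: inner_diff_left[of "x - ?p" "x - y"])
    then show "y = ?p" by simp
  qed (use p o in auto)
qed

lemma proj_matrix_vector:
  assumes "S \<subseteq> V"
  shows "proj_matrix S *v x = (\<Sum>v\<in>S. (x \<bullet> v) *\<^sub>R v)"
proof -
  have "orth_proj (span S) = (\<lambda>x. \<Sum>v\<in>S. (x \<bullet> v) *\<^sub>R v)"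
    using orth_proj_patch[OF assms] by blast
  moreover have "linear (\<lambda>x::real^'n. \<Sum>v\<in>S. (x \<bullet> v) *\<^sub>R v)"
    by (intro linear_compose_sum ballI linearI) (simp_all add: inner_add_left scaleR_add_left)
  ultimately show ?thesis unfolding proj_matrix_def by (simp add: matrix_works)
qed

lemma proj_matrix_in_span: "S \<subseteq> V \<Longrightarrow> proj_matrix S *v x \<in> span S"
  by (simp add: proj_matrix_vector span_sum span_scale span_base)

lemma proj_matrix_fixes: "S \<subseteq> V \<Longrightarrow> x \<in> span S \<Longrightarrow> proj_matrix S *v x = x"
  by (simp add: proj_matrix_vector span_expand)

lemma proj_matrix_inner:
  assumes "S \<subseteq> V" "x \<in> span S"
  shows "x \<bullet> (proj_matrix S *v y) = x \<bullet> y"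
proof -
  have "x \<bullet> (proj_matrix S *v y) = (\<Sum>v\<in>S. (x \<bullet> v) *\<^sub>R v) \<bullet> y"
    by (simp add: proj_matrix_vector assms(1) inner_sum_left inner_sum_right inner_commute[of _ y] mult.commute)
  then show ?thesis by (simp add: span_expand assms)
qed

section \<open>Energies and their diagonal majorants\<close>

lemma energy_diag_vector:
  "energy_diag V B *v x = (\<Sum>v\<in>V. ((\<Sum>u\<in>V. \<bar>v \<bullet> (B *v u)\<bar>) * (v \<bullet> x)) *\<^sub>R v)"
  by (simp add: energy_diag_def sum_matrix_vector_mult outer_product_vector
      flip: scaleR_matrix_vector_assoc)

lemma energy_diag_form:
  "x \<bullet> (energy_diag V B *v x) = (\<Sum>v\<in>V. (\<Sum>u\<in>V. \<bar>v \<bullet> (B *v u)\<bar>) * (x \<bullet> v)\<^sup>2)"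
  by (simp add: energy_diag_vector inner_sum_right inner_commute[of _ x] power2_eq_square mult.assoc)

lemma energy_diag_nonneg: "0 \<le> x \<bullet> (energy_diag V B *v x)"
  by (simp add: energy_diag_form sum_nonneg)

lemma energy_diag_in_span:
  assumes "S \<subseteq> V" "x \<in> span S"
  shows "energy_diag V B *v x \<in> span S"
  unfolding energy_diag_vector
proof (rule span_sum)
  fix v assume "v \<in> V"
  then show "((\<Sum>u\<in>V. \<bar>v \<bullet> (B *v u)\<bar>) * (v \<bullet> x)) *\<^sub>R v \<in> span S"
    using assms span_patch_iff[OF assms(1), of x]
    by (cases "v \<in> S") (simp_all add: span_scale span_base span_zero inner_commute[of _ x])
qed

text \<open>The off-diagonal entries are absorbed by the arithmetic-geometric mean inequality
  \<open>2 x\<^sub>v x\<^sub>u \<le> x\<^sub>v\<^sup>2 + x\<^sub>u\<^sup>2\<close>; symmetry of \<open>B\<close> lets both halves land on the same diagonal.\<close>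
lemma energy_le_diag:
  assumes "transpose B = B"
  shows "x \<bullet> (B *v x) \<le> x \<bullet> (energy_diag V B *v x)"
proof -
  let ?b = "\<lambda>v u. v \<bullet> (B *v u)"
  have x: "x = (\<Sum>v\<in>V. (x \<bullet> v) *\<^sub>R v)" using span_expand[of V x] span_basis by simp
  have sym: "?b v u = ?b u v" for u v
    using symmetric_inner[OF assms, of v u] by (simp add: inner_commute)
  have "B *v x = (\<Sum>u\<in>V. (x \<bullet> u) *\<^sub>R (B *v u))"
    by (subst x, subst linear_sum[OF matrix_vector_mul_linear])
      (simp add: matrix_vector_mult_scaleR)
  then have "x \<bullet> (B *v x) = (\<Sum>v\<in>V. (x \<bullet> v) *\<^sub>R v) \<bullet> (\<Sum>u\<in>V. (x \<bullet> u) *\<^sub>R (B *v u))"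
    using x by simp
  also have "\<dots> = (\<Sum>v\<in>V. \<Sum>u\<in>V. (x \<bullet> v) * (x \<bullet> u) * ?b v u)"
    by (subst sum.swap) (simp add: inner_sum_left inner_sum_right sum_distrib_left mult_ac)
  also have "\<dots> \<le> (\<Sum>v\<in>V. \<Sum>u\<in>V. \<bar>?b v u\<bar> * (x \<bullet> v)\<^sup>2 / 2 + \<bar>?b v u\<bar> * (x \<bullet> u)\<^sup>2 / 2)"
  proof (intro sum_mono)
    fix v u
    have "(x \<bullet> v) * (x \<bullet> u) * ?b v u \<le> \<bar>(x \<bullet> v) * (x \<bullet> u)\<bar> * \<bar>?b v u\<bar>"
      by (metis abs_ge_self abs_mult)
    also have "\<bar>(x \<bullet> v) * (x \<bullet> u)\<bar> \<le> ((x \<bullet> v)\<^sup>2 + (x \<bullet> u)\<^sup>2) / 2"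
      using sum_squares_bound[of "\<bar>x \<bullet> v\<bar>" "\<bar>x \<bullet> u\<bar>"] by (simp add: abs_mult)
    then have "\<bar>(x \<bullet> v) * (x \<bullet> u)\<bar> * \<bar>?b v u\<bar> \<le> ((x \<bullet> v)\<^sup>2 + (x \<bullet> u)\<^sup>2) / 2 * \<bar>?b v u\<bar>"
      by (rule mult_right_mono) simp
    finally show "(x \<bullet> v) * (x \<bullet> u) * ?b v u
        \<le> \<bar>?b v u\<bar> * (x \<bullet> v)\<^sup>2 / 2 + \<bar>?b v u\<bar> * (x \<bullet> u)\<^sup>2 / 2"
      by (simp add: field_simps)
  qed
  also have "\<dots> = (\<Sum>v\<in>V. \<Sum>u\<in>V. \<bar>?b v u\<bar> * (x \<bullet> v)\<^sup>2 / 2)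
      + (\<Sum>v\<in>V. \<Sum>u\<in>V. \<bar>?b v u\<bar> * (x \<bullet> u)\<^sup>2 / 2)"
    by (simp add: sum.distrib)
  also have "(\<Sum>v\<in>V. \<Sum>u\<in>V. \<bar>?b v u\<bar> * (x \<bullet> u)\<^sup>2 / 2)
      = (\<Sum>v\<in>V. \<Sum>u\<in>V. \<bar>?b v u\<bar> * (x \<bullet> v)\<^sup>2 / 2)"
    by (subst sum.swap) (simp add: sym)
  also have "(\<Sum>v\<in>V. \<Sum>u\<in>V. \<bar>?b v u\<bar> * (x \<bullet> v)\<^sup>2 / 2) + \<dots>
      = x \<bullet> (energy_diag V B *v x)"
    by (simp add: energy_diag_form sum_distrib_right flip: sum.distrib)
  finally show ?thesis .
qed

lemma energy_kernel_outside:
  assumes "psd_matrix B" "v \<in> V" "v \<notin> energy_nbhd V B"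
  shows "B *v v = 0"
proof -
  have "0 \<le> v \<bullet> (B *v v)" using assms(1) by (simp add: psd_matrix_def)
  then have "v \<bullet> (B *v v) = 0" using assms(2,3) by (simp add: energy_nbhd_def)
  then show ?thesis by (rule psd_kernel[OF assms(1)])
qed

lemma energy_kernel_disjoint:
  assumes "psd_matrix B" "S \<subseteq> V" "energy_nbhd V B \<inter> S = {}" "x \<in> span S"
  shows "B *v x = 0"
proof -
  have "B *v (\<Sum>v\<in>S. (x \<bullet> v) *\<^sub>R v) = (\<Sum>v\<in>S. (x \<bullet> v) *\<^sub>R (B *v v))"
    by (subst linear_sum[OF matrix_vector_mul_linear]) (simp add: matrix_vector_mult_scaleR)
  also have "\<dots> = 0"
    using assms by (intro sum.neutral) (auto intro!: energy_kernel_outside)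
  finally show ?thesis by (simp add: span_expand assms)
qed

text \<open>Orthogonality of the range of an energy to the basis vectors outside \<open>S\<close> is, by symmetry, the same
  as annihilating those vectors.\<close>
lemma energy_inside_in_span:
  assumes "psd_matrix B" "S \<subseteq> V" "energy_inside V B S"
  shows "B *v x \<in> span S"
  unfolding span_patch_iff[OF assms(2)]
proof
  fix v assume v: "v \<in> V - S"
  then have "B *v v = 0"
    using assms by (intro energy_kernel_outside) (auto simp: energy_inside_def)
  then show "(B *v x) \<bullet> v = 0"
    using symmetric_inner[of B x v] assms(1) by (simp add: psd_matrix_def)
qed

lemma energy_diag_untouched:
  assumes "psd_matrix B" "S \<subseteq> V" "\<not> energy_touches V B S" "x \<in> span S"
  shows "x \<bullet> (energy_diag V B *v x) = 0"
  unfolding energy_diag_form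
proof (rule sum.neutral, rule ballI)
  fix v assume v: "v \<in> V"
  show "(\<Sum>u\<in>V. \<bar>v \<bullet> (B *v u)\<bar>) * (x \<bullet> v)\<^sup>2 = 0"
  proof (cases "v \<in> S")
    case True
    then have "B *v v = 0"
      using assms v by (intro energy_kernel_outside) (auto simp: energy_touches_def)
    then have "v \<bullet> (B *v u) = 0" for u
      using symmetric_inner[of B v u] assms(1) by (simp add: psd_matrix_def)
    then show ?thesis by simp
  next
    case False
    then show ?thesis using span_patch_iff[OF assms(2)] assms(4) v by simp
  qed
qed

text \<open>On \<open>span S\<close> the projections disappear, and energies that do not touch \<open>S\<close> may be
  included with their diagonal, because it vanishes there. Each energy then contributes either
  itself or its diagonal.\<close>
lemma closed_energy_form:
  assumes "\<And>k. k \<in> {1..m} \<Longrightarrow> psd_matrix (E k)" "S \<subseteq> V" "z \<in> span S"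
  shows "z \<bullet> (closed_energy m E V S *v z) =
    (\<Sum>k=1..m. if energy_inside V (E k) S then z \<bullet> (E k *v z)
                else z \<bullet> (energy_diag V (E k) *v z))"
proof -
  let ?in = "\<lambda>k. energy_inside V (E k) S" and ?t = "\<lambda>k. energy_touches V (E k) S"
  let ?D = "\<lambda>k. proj_matrix S ** energy_diag V (E k) ** proj_matrix S"
  have D: "z \<bullet> (?D k *v z) = z \<bullet> (energy_diag V (E k) *v z)" for k
    by (simp add: proj_matrix_fixes proj_matrix_inner assms flip: matrix_vector_mul_assoc)
  have "z \<bullet> (closed_energy m E V S *v z) =
      (\<Sum>k | k \<in> {1..m} \<and> ?in k. z \<bullet> (E k *v z))
      + (\<Sum>k | k \<in> {1..m} \<and> \<not> ?in k \<and> ?t k. z \<bullet> (?D k *v z))"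
    by (simp add: closed_energy_def matrix_vector_mult_add_rdistrib sum_matrix_vector_mult
        inner_add_right inner_sum_right)
  also have "\<dots> = (\<Sum>k | k \<in> {1..m} \<and> ?in k. z \<bullet> (E k *v z))
      + (\<Sum>k | k \<in> {1..m} \<and> \<not> ?in k. z \<bullet> (energy_diag V (E k) *v z))"
    unfolding D using assms
    by (intro arg_cong2[where f = "(+)"] refl sum.mono_neutral_left)
      (auto intro!: energy_diag_untouched[OF _ assms(2) _ assms(3)])
  also have "\<dots> = (\<Sum>k=1..m. if ?in k then z \<bullet> (E k *v z)
      else z \<bullet> (energy_diag V (E k) *v z))"
    by (subst sum.If_cases) (auto intro!: arg_cong2[where f = "(+)"] sum.cong)
  finally show ?thesis .
qed

lemma closed_energy_in_span:
  assumes "\<And>k. k \<in> {1..m} \<Longrightarrow> psd_matrix (E k)" "S \<subseteq> V"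
  shows "closed_energy m E V S *v x \<in> span S"
  unfolding closed_energy_def matrix_vector_mult_add_rdistrib sum_matrix_vector_mult
  using assms
  by (intro span_add span_sum)
    (auto intro!: energy_inside_in_span proj_matrix_in_span simp flip: matrix_vector_mul_assoc)

end

section \<open>Decoupling the energy over a partition\<close>

locale patched_energy = vector_orthonormal_basis V for V :: "(real^'n) set" +
  fixes A :: "real^'n^'n" and E :: "nat \<Rightarrow> real^'n^'n" and m :: nat
    and P :: "nat \<Rightarrow> (real^'n) set" and M :: nat
  assumes spd: "spd_matrix A"
    and decomposition: "energy_decomposition A m E"
    and partition: "indexed_partition V M P"
begin

lemma psd_energy: "k \<in> {1..m} \<Longrightarrow> psd_matrix (E k)"
  using decomposition unfolding energy_decomposition_def by blast

lemma patch_subset: "j \<in> {1..M} \<Longrightarrow> P j \<subseteq> V"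
  using partition unfolding indexed_partition_def by blast

lemma patch_disjoint: "i \<in> {1..M} \<Longrightarrow> j \<in> {1..M} \<Longrightarrow> i \<noteq> j \<Longrightarrow> P i \<inter> P j = {}"
  using partition unfolding indexed_partition_def disjoint_family_on_def by blast

lemma inner_patches:
  assumes "i \<in> {1..M}" "j \<in> {1..M}" "i \<noteq> j" "x \<in> span (P i)" "y \<in> span (P j)"
  shows "x \<bullet> y = 0"
  using inner_span_disjoint[OF patch_subset patch_subset patch_disjoint] assms by blast

lemma inner_patch_sums:
  assumes "\<And>j. j \<in> {1..M} \<Longrightarrow> a j \<in> span (P j)" "\<And>j. j \<in> {1..M} \<Longrightarrow> b j \<in> span (P j)"
  shows "(\<Sum>j=1..M. a j) \<bullet> (\<Sum>j=1..M. b j) = (\<Sum>j=1..M. a j \<bullet> b j)"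
proof -
  have "(\<Sum>j=1..M. a j \<bullet> b i) = a i \<bullet> b i" if "i \<in> {1..M}" for i
  proof -
    have "(\<Sum>j=1..M. a j \<bullet> b i) = (\<Sum>j=1..M. if j = i then a j \<bullet> b i else 0)"
      using that assms by (intro sum.cong) (auto intro: inner_patches)
    then show ?thesis using that by simp
  qed
  then show ?thesis by (simp add: inner_sum_left inner_sum_right)
qed

text \<open>An energy inside one patch sees only that component of \<open>z\<close>. An energy inside no patch is
  first replaced by its diagonal, which then splits over the patches exactly.\<close>
lemma energy_le_patch_sum:
  assumes psd: "psd_matrix B" and z: "\<And>j. j \<in> {1..M} \<Longrightarrow> z j \<in> span (P j)"
  shows "(\<Sum>j=1..M. z j) \<bullet> (B *v (\<Sum>j=1..M. z j)) \<le>
    (\<Sum>j=1..M. if energy_inside V B (P j) then z j \<bullet> (B *v z j)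
                else z j \<bullet> (energy_diag V B *v z j))"
    (is "?Z \<bullet> _ \<le> (\<Sum>j=1..M. ?q j)")
proof -
  have sym: "transpose B = B" using psd by (simp add: psd_matrix_def)
  show ?thesis
  proof (cases "\<exists>i\<in>{1..M}. energy_inside V B (P i)")
    case True
    then obtain i where i: "i \<in> {1..M}" "energy_inside V B (P i)" by blast
    have "B *v z j = 0" if "j \<in> {1..M}" "j \<noteq> i" for j
    proof (rule energy_kernel_disjoint[OF psd patch_subset[OF that(1)] _ z[OF that(1)]])
      show "energy_nbhd V B \<inter> P j = {}"
        using i patch_disjoint[OF that(1) i(1) that(2)] by (auto simp: energy_inside_def)
    qed
    then have "(\<Sum>j=1..M. B *v z j) = (\<Sum>j=1..M. if j = i then B *v z j else 0)"
      by (intro sum.cong) auto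
    then have Bz: "B *v ?Z = B *v z i"
      using i(1) by (simp add: linear_sum[OF matrix_vector_mul_linear])
    have "?Z \<bullet> (B *v ?Z) = (B *v ?Z) \<bullet> z i"
      using Bz symmetric_inner[OF sym] by metis
    also have "\<dots> = ?q i" using i(2) Bz by (simp add: inner_commute)
    also have "\<dots> \<le> (\<Sum>j=1..M. ?q j)"
      using i(1) psd by (intro member_le_sum) (auto simp: psd_matrix_def energy_diag_nonneg)
    finally show ?thesis .
  next
    case False
    have "?Z \<bullet> (B *v ?Z) \<le> ?Z \<bullet> (energy_diag V B *v ?Z)"
      by (rule energy_le_diag[OF sym])
    also have "\<dots> = ?Z \<bullet> (\<Sum>j=1..M. energy_diag V B *v z j)"
      by (simp add: linear_sum[OF matrix_vector_mul_linear])
    also have "\<dots> = (\<Sum>j=1..M. z j \<bullet> (energy_diag V B *v z j))"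
      using z by (intro inner_patch_sums energy_diag_in_span patch_subset)
    also have "\<dots> = (\<Sum>j=1..M. ?q j)"
      using False by (intro sum.cong) auto
    finally show ?thesis .
  qed
qed

text \<open>Summed over all energies, the previous bound says that the block diagonal operator built from
  the closed energies dominates \<open>A\<close>.\<close>
lemma energy_le_closed_energies:
  assumes z: "\<And>j. j \<in> {1..M} \<Longrightarrow> z j \<in> span (P j)"
  shows "(\<Sum>j=1..M. z j) \<bullet> (A *v (\<Sum>j=1..M. z j)) \<le>
    (\<Sum>j=1..M. z j \<bullet> (closed_energy m E V (P j) *v z j))"
proof -
  let ?Z = "\<Sum>j=1..M. z j"
  have "?Z \<bullet> (A *v ?Z) = (\<Sum>k=1..m. ?Z \<bullet> (E k *v ?Z))"
    using decomposition by (simp add: energy_decomposition_def sum_matrix_vector_mult inner_sum_right)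
  also have "\<dots> \<le> (\<Sum>k=1..m. \<Sum>j=1..M. if energy_inside V (E k) (P j) then z j \<bullet> (E k *v z j)
                else z j \<bullet> (energy_diag V (E k) *v z j))"
    using z by (intro sum_mono energy_le_patch_sum psd_energy)
  also have "\<dots> = (\<Sum>j=1..M. z j \<bullet> (closed_energy m E V (P j) *v z j))"
    by (subst sum.swap, intro sum.cong refl closed_energy_form[symmetric] psd_energy patch_subset z)
  finally show ?thesis .
qed

text \<open>Testing the domination with a family supported on one patch transfers definiteness from \<open>A\<close>
  to each closed energy; this is what makes the closed energies invertible on their patches.\<close>
lemma closed_energy_pos:
  assumes j: "j \<in> {1..M}" and z: "z \<in> span (P j)" "z \<noteq> 0"
  shows "0 < z \<bullet> (closed_energy m E V (P j) *v z)"
proof -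
  let ?z = "\<lambda>i. if i = j then z else 0"
  have "0 < z \<bullet> (A *v z)" using spd z(2) by (simp add: spd_matrix_def)
  also have "\<dots> = (\<Sum>i=1..M. ?z i) \<bullet> (A *v (\<Sum>i=1..M. ?z i))" using j by simp
  also have "\<dots> \<le> (\<Sum>i=1..M. ?z i \<bullet> (closed_energy m E V (P i) *v ?z i))"
    using z(1) by (intro energy_le_closed_energies) (simp add: span_zero)
  also have "\<dots> = (\<Sum>i=1..M. if i = j then z \<bullet> (closed_energy m E V (P i) *v z) else 0)"
    by (intro sum.cong) auto
  finally show ?thesis using j by simp
qed

section \<open>Inverses of the closed energies and the condition factor\<close>

lemma closed_energy_bij:
  assumes j: "j \<in> {1..M}"
  shows "bij_betw (\<lambda>x. closed_energy m E V (P j) *v x) (span (P j)) (span (P j))"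
proof -
  let ?f = "\<lambda>x. closed_energy m E V (P j) *v x"
  have lin: "linear ?f" by simp
  have inj: "inj_on ?f (span (P j))"
  proof (rule inj_onI, rule ccontr)
    fix x y assume *: "x \<in> span (P j)" "y \<in> span (P j)" "?f x = ?f y" "x \<noteq> y"
    then have "0 < (x - y) \<bullet> ?f (x - y)"
      by (intro closed_energy_pos[OF j]) (auto intro: span_diff)
    with * show False by (simp add: matrix_vector_mult_diff_distrib)
  qed
  have "?f ` span (P j) = span (P j)"
  proof (rule subspace_dim_equal)
    show "subspace (?f ` span (P j))" by (rule linear_subspace_image[OF lin subspace_span])
    show "?f ` span (P j) \<subseteq> span (P j)"
      using closed_energy_in_span[of m E, OF psd_energy patch_subset[OF j]] by blast
    show "dim (span (P j)) \<le> dim (?f ` span (P j))"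
      using dim_image_eq[OF lin, of "span (P j)"] inj by (simp add: span_span)
  qed simp
  then show ?thesis using inj by (simp add: bij_betw_def)
qed

lemma closed_energy_inv:
  assumes "j \<in> {1..M}" "y \<in> span (P j)"
  shows "closed_energy_inv m E V (P j) y \<in> span (P j)"
    and "closed_energy m E V (P j) *v closed_energy_inv m E V (P j) y = y"
  using closed_energy_bij[OF assms(1)] assms(2)
  by (auto simp: closed_energy_inv_def bij_betw_def intro: inv_into_into f_inv_into_f)

lemma closed_energy_inv_pos:
  assumes j: "j \<in> {1..M}" and y: "y \<in> span (P j)" "y \<noteq> 0"
  shows "0 < y \<bullet> closed_energy_inv m E V (P j) y"
proof -
  let ?z = "closed_energy_inv m E V (P j) y"
  note inv = closed_energy_inv[OF j y(1)]
  have "?z \<noteq> 0" using inv(2) y(2) by auto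
  then have "0 < ?z \<bullet> (closed_energy m E V (P j) *v ?z)"
    by (rule closed_energy_pos[OF j inv(1)])
  then show ?thesis by (simp only: inv(2) inner_commute)
qed

text \<open>A linear map agreeing with the partial inverse makes the condition quotient visibly
  continuous.\<close>
lemma closed_energy_inv_linear_extension:
  assumes j: "j \<in> {1..M}"
  obtains g where "linear g" "\<And>y. y \<in> span (P j) \<Longrightarrow> g y = closed_energy_inv m E V (P j) y"
proof -
  let ?f = "\<lambda>x. closed_energy m E V (P j) *v x"
  have "inj_on ?f (span (P j))" using closed_energy_bij[OF j] by (simp add: bij_betw_def)
  then obtain g where g: "linear g" "\<And>x. x \<in> span (P j) \<Longrightarrow> g (?f x) = x"
    using linear_inj_on_left_inverse[of ?f "P j"] by auto
  have "g y = closed_energy_inv m E V (P j) y" if "y \<in> span (P j)" for y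
    using g(2)[OF closed_energy_inv(1)[OF j that]] closed_energy_inv(2)[OF j that] by simp
  with g(1) show thesis by (rule that)
qed

text \<open>The quotient depends only on the direction of \<open>x\<close> and is continuous on the compact unit sphere
  of \<open>span F\<close>, so it attains its greatest value. If \<open>F\<close> contained only the zero vector, there
  would be no quotient at all.\<close>
lemma patch_condition_factor_greatest:
  assumes j: "j \<in> {1..M}" and F: "F \<subseteq> span (P j)" "f \<in> F" "f \<noteq> 0"
  shows "\<exists>x. x \<in> span F \<and> x \<noteq> 0 \<and> patch_condition_factor m E V (P j) F =
      (x \<bullet> x) / (x \<bullet> closed_energy_inv m E V (P j) x)"
    and "y \<in> span F \<Longrightarrow> y \<noteq> 0 \<Longrightarrow>
      (y \<bullet> y) / (y \<bullet> closed_energy_inv m E V (P j) y) \<le> patch_condition_factor m E V (P j) F"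
proof -
  let ?inv = "closed_energy_inv m E V (P j)"
  let ?r = "\<lambda>x. (x \<bullet> x) / (x \<bullet> ?inv x)"
  let ?K = "sphere 0 1 \<inter> span F"
  obtain g where g: "linear g" "\<And>y. y \<in> span (P j) \<Longrightarrow> g y = ?inv y"
    using closed_energy_inv_linear_extension[OF j] by blast
  have sub: "span F \<subseteq> span (P j)" using F(1) by (simp add: span_minimal)
  have gF: "?inv y = g y" if "y \<in> span F" for y using that sub g(2) by auto
  have pos: "0 < y \<bullet> g y" if "y \<in> span F" "y \<noteq> 0" for y
    using closed_energy_inv_pos[OF j _ that(2)] that(1) sub gF by auto
  have nz: "y \<bullet> g y \<noteq> 0" if "y \<in> ?K" for y using pos[of y] that by force
  have "compact ?K" by (intro compact_Int_closed closed_span) simp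
  moreover have "f /\<^sub>R norm f \<in> ?K" using F by (simp add: span_scale span_base)
  then have "?K \<noteq> {}" by blast
  moreover have "continuous_on ?K (\<lambda>x. (x \<bullet> x) / (x \<bullet> g x))"
    using nz g(1) by (intro continuous_intros linear_continuous_on linear_conv_bounded_linear[THEN iffD1]) auto
  ultimately obtain u where u: "u \<in> ?K"
    and max: "\<And>y. y \<in> ?K \<Longrightarrow> (y \<bullet> y) / (y \<bullet> g y) \<le> (u \<bullet> u) / (u \<bullet> g u)"
    using continuous_attains_sup[of ?K "\<lambda>x. (x \<bullet> x) / (x \<bullet> g x)"] by blast
  have le: "?r y \<le> ?r u" if y: "y \<in> span F" "y \<noteq> 0" for y
  proof -
    let ?y = "y /\<^sub>R norm y"
    have "?y \<in> ?K" using y by (simp add: span_scale)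
    then have "(?y \<bullet> ?y) / (?y \<bullet> g ?y) \<le> (u \<bullet> u) / (u \<bullet> g u)" by (rule max)
    moreover have "(?y \<bullet> ?y) / (?y \<bullet> g ?y) = (y \<bullet> y) / (y \<bullet> g y)"
      using y(2) by (simp add: linear_cmul[OF g(1)] field_simps)
    ultimately show ?thesis using gF[OF y(1)] gF[of u] u by simp
  qed
  have u0: "u \<in> span F" "u \<noteq> 0" using u by auto
  have "F \<noteq> {}" using F(2) by blast
  then have "patch_condition_factor m E V (P j) F = ?r u"
    unfolding patch_condition_factor_def using le u0
    by (simp, intro Greatest_equality) blast+
  with le u0 show "\<exists>x. x \<in> span F \<and> x \<noteq> 0 \<and> patch_condition_factor m E V (P j) F = ?r x"
    and "y \<in> span F \<Longrightarrow> y \<noteq> 0 \<Longrightarrow> ?r y \<le> patch_condition_factor m E V (P j) F"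
    by auto
qed

lemma patch_condition_factor_nonneg:
  assumes "j \<in> {1..M}" "F \<subseteq> span (P j)" "0 \<notin> F"
  shows "0 \<le> patch_condition_factor m E V (P j) F"
proof (cases "F = {}")
  case False
  then obtain f where f: "f \<in> F" "f \<noteq> 0" using assms(3) by blast
  obtain x where x: "x \<in> span F" "x \<noteq> 0"
    and eq: "patch_condition_factor m E V (P j) F = (x \<bullet> x) / (x \<bullet> closed_energy_inv m E V (P j) x)"
    using patch_condition_factor_greatest(1)[OF assms(1,2) f] by blast
  have "x \<in> span (P j)" using x(1) assms(2) span_minimal[of F "span (P j)"] by auto
  then have "0 < x \<bullet> closed_energy_inv m E V (P j) x"
    using closed_energy_inv_pos[OF assms(1)] x(2) by blast
  then show ?thesis by (simp add: eq)
qed (simp add: patch_condition_factor_def)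

lemma patch_condition_factor_bound:
  assumes j: "j \<in> {1..M}" and F: "F \<subseteq> span (P j)" "0 \<notin> F" and y: "y \<in> span F"
  shows "y \<bullet> y \<le> patch_condition_factor m E V (P j) F * (y \<bullet> closed_energy_inv m E V (P j) y)"
proof (cases "y = 0")
  case False
  then have "F \<noteq> {}" using y by auto
  then obtain f where f: "f \<in> F" "f \<noteq> 0" using F(2) by blast
  have "y \<in> span (P j)" using y F(1) span_minimal[of F "span (P j)"] by auto
  then have "0 < y \<bullet> closed_energy_inv m E V (P j) y"
    using closed_energy_inv_pos[OF j] False by blast
  then show ?thesis
    using patch_condition_factor_greatest(2)[OF j F(1) f y False] by (simp add: field_simps)
qed simp

text \<open>Legendre duality reverses the bound of \<open>A\<close> by the closed energies: the test vector
  \<open>z = \<Sum>\<^sub>j z\<^sub>j\<close> with \<open>z\<^sub>j\<close> solving the local problem on patch \<open>j\<close> gives a lower bound for the form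
  of \<open>A\<^sup>-\<^sup>1\<close>.\<close>
lemma closed_energy_inverses_le:
  assumes y: "\<And>j. j \<in> {1..M} \<Longrightarrow> y j \<in> span (P j)"
  shows "(\<Sum>j=1..M. y j \<bullet> closed_energy_inv m E V (P j) (y j)) \<le>
    (\<Sum>j=1..M. y j) \<bullet> (matrix_inv A *v (\<Sum>j=1..M. y j))"
proof -
  let ?z = "\<lambda>j. closed_energy_inv m E V (P j) (y j)"
  let ?Y = "\<Sum>j=1..M. y j" and ?Z = "\<Sum>j=1..M. ?z j"
  have z: "?z j \<in> span (P j)" if "j \<in> {1..M}" for j
    using that y by (intro closed_energy_inv)
  have "?Z \<bullet> (A *v ?Z) \<le> (\<Sum>j=1..M. ?z j \<bullet> (closed_energy m E V (P j) *v ?z j))"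
    using z by (rule energy_le_closed_energies)
  also have "\<dots> = (\<Sum>j=1..M. y j \<bullet> ?z j)"
    using y by (intro sum.cong refl) (simp add: closed_energy_inv(2) inner_commute)
  finally have "?Z \<bullet> (A *v ?Z) \<le> (\<Sum>j=1..M. y j \<bullet> ?z j)" .
  moreover have "?Y \<bullet> ?Z = (\<Sum>j=1..M. y j \<bullet> ?z j)"
    using y z by (rule inner_patch_sums)
  ultimately show ?thesis using spd_inverse_form_ge[OF spd, of ?Y ?Z] by linarith
qed

end

section \<open>The stiffness matrix\<close>

locale patched_columns = patched_energy V A E m P M
  for V A E m P M +
  fixes \<Phi> :: "real^'c^'n" and blk :: "'c \<Rightarrow> nat"
  assumes blk: "blk c \<in> {1..M}"
    and columns: "j \<in> {1..M} \<Longrightarrow> \<exists>W. subspace W \<and> W \<subseteq> span (P j) \<and>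
           orthonormal_basis_on {c. blk c = j} (\<lambda>c. column c \<Phi>) W"
begin

lemma column_in_patch: "column c \<Phi> \<in> span (P (blk c))"
proof -
  obtain W where "W \<subseteq> span (P (blk c))"
      "orthonormal_basis_on {d. blk d = blk c} (\<lambda>d. column d \<Phi>) W"
    using columns[OF blk] by blast
  then show ?thesis unfolding orthonormal_basis_on_def by (auto intro: span_base)
qed

lemma columns_orthonormal: "column c \<Phi> \<bullet> column d \<Phi> = (if c = d then 1 else 0)"
proof (cases "blk c = blk d")
  case True
  obtain W where "orthonormal_basis_on {e. blk e = blk c} (\<lambda>e. column e \<Phi>) W"
    using columns[OF blk] by blast
  then show ?thesis using True unfolding orthonormal_basis_on_def by simp
next
  case False
  then show ?thesis using inner_patches[OF blk blk _ column_in_patch column_in_patch] by auto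
qed

lemma columns_isometry: "(\<Phi> *v x) \<bullet> (\<Phi> *v x) = x \<bullet> x"
proof -
  have "\<Phi> *v x = (\<Sum>c\<in>UNIV. (x $ c) *\<^sub>R column c \<Phi>)"
    by (simp add: matrix_mult_sum scalar_mult_eq_scaleR)
  then have "(\<Phi> *v x) \<bullet> (\<Phi> *v x) = (\<Sum>c\<in>UNIV. \<Sum>d\<in>UNIV. x $ c * (x $ d * (column d \<Phi> \<bullet> column c \<Phi>)))"
    by (simp add: inner_sum_left inner_sum_right sum_distrib_left)
  also have "\<dots> = x \<bullet> x"
    by (simp add: columns_orthonormal inner_vec_def[of x x] if_distrib cong: if_cong)
  finally show ?thesis .
qed

abbreviation "gram \<equiv> transpose \<Phi> ** matrix_inv A ** \<Phi>"

lemma gram_form: "x \<bullet> (gram *v x) = (\<Phi> *v x) \<bullet> (matrix_inv A *v (\<Phi> *v x))"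
proof -
  have "gram *v x = transpose \<Phi> *v (matrix_inv A *v (\<Phi> *v x))"
    by (simp only: matrix_vector_mul_assoc matrix_mul_assoc)
  then show ?thesis
    using transpose_inner[of x "transpose \<Phi>" "matrix_inv A *v (\<Phi> *v x)"]
    by (simp only: transpose_transpose)
qed

lemma gram_spd: "spd_matrix gram"
proof -
  have inv: "spd_matrix (matrix_inv A)" using spd by (rule spd_inverse)
  then have "transpose gram = gram"
    by (simp add: matrix_transpose_mul spd_matrix_def matrix_mul_assoc)
  moreover have "0 < x \<bullet> (gram *v x)" if "x \<noteq> 0" for x
  proof -
    have "\<Phi> *v x \<noteq> 0" using columns_isometry[of x] that by auto
    then show ?thesis using inv unfolding gram_form spd_matrix_def by blast
  qed
  ultimately show ?thesis by (simp add: spd_matrix_def)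
qed

text \<open>Expanding \<open>\<Psi>\<^sup>T A \<Psi>\<close>, the factors \<open>A\<close> and \<open>A\<^sup>-\<^sup>1\<close> cancel and leave one Gram matrix between two
  of its inverses. Extreme eigenvalues of the stiffness matrix are thus reciprocals of those of
  the Gram matrix.\<close>
lemma stiffness_eq_gram_inverse: "stiffness_matrix A \<Phi> = matrix_inv gram"
proof -
  let ?A' = "matrix_inv A" and ?G' = "matrix_inv gram"
  have symA: "transpose ?A' = ?A'" and symG: "transpose ?G' = ?G'"
    using spd_inverse[OF spd] spd_inverse[OF gram_spd] by (simp_all add: spd_matrix_def)
  have "stiffness_matrix A \<Phi> = (?G' ** (transpose \<Phi> ** ?A')) ** A ** (?A' ** \<Phi> ** ?G')"
    by (simp add: stiffness_matrix_def basis_Psi_def matrix_transpose_mul symA symG)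
  also have "\<dots> = ?G' ** transpose \<Phi> ** ?A' ** (A ** ?A') ** \<Phi> ** ?G'"
    by (simp only: matrix_mul_assoc)
  also have "\<dots> = ?G' ** gram ** ?G'"
    by (simp add: spd_matrix_inv[OF spd] matrix_mul_assoc)
  also have "\<dots> = ?G'" by (simp add: spd_matrix_inv[OF gram_spd])
  finally show ?thesis .
qed

text \<open>Since \<open>\<Phi>\<close> is an isometry, the form of the Gram matrix is a restriction of the form of
  \<open>A\<^sup>-\<^sup>1\<close>, and its quotients cannot exceed those of \<open>A\<^sup>-\<^sup>1\<close>.\<close>
lemma gram_rayleigh_le: "x \<bullet> (gram *v x) \<le> 1 / lambda_min A * (x \<bullet> x)"
proof -
  have "transpose (matrix_inv A) = matrix_inv A"
    using spd_inverse[OF spd] by (simp add: spd_matrix_def)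
  from symmetric_lambda_max(2)[OF this, of "\<Phi> *v x"] show ?thesis
    by (simp add: gram_form columns_isometry spd_lambda_max_inverse[OF spd])
qed

lemma condition_factor_ge:
  "j \<in> {1..M} \<Longrightarrow> patch_condition_factor m E V (P j) (block_columns \<Phi> blk j)
    \<le> condition_factor m E V M P \<Phi> blk"
  unfolding condition_factor_def by (intro Max_ge) auto

text \<open>Splitting \<open>\<Phi> x\<close> by blocks gives one component in each patch. These are orthogonal, and
  the condition factor controls each against its local inverse energy.\<close>
lemma gram_rayleigh_ge: "x \<bullet> x \<le> condition_factor m E V M P \<Phi> blk * (x \<bullet> (gram *v x))"
proof -
  let ?\<delta> = "condition_factor m E V M P \<Phi> blk"
  let ?F = "block_columns \<Phi> blk"
  let ?\<delta>j = "\<lambda>j. patch_condition_factor m E V (P j) (?F j)"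
  let ?inv = "\<lambda>j. closed_energy_inv m E V (P j)"
  define y where "y j = (\<Sum>c | blk c = j. (x $ c) *\<^sub>R column c \<Phi>)" for j
  have F: "?F j \<subseteq> span (P j)" "0 \<notin> ?F j" for j
    using column_in_patch columns_orthonormal unfolding block_columns_def
    by (auto, metis inner_zero_left zero_neq_one)
  have yF: "y j \<in> span (?F j)" for j
    unfolding y_def block_columns_def by (intro span_sum span_scale span_base) auto
  have y: "y j \<in> span (P j)" for j
    using yF[of j] span_minimal[OF F(1) subspace_span] by blast
  have "\<Phi> *v x = (\<Sum>c\<in>UNIV. (x $ c) *\<^sub>R column c \<Phi>)"
    by (simp add: matrix_mult_sum scalar_mult_eq_scaleR)
  also have "\<dots> = (\<Sum>j=1..M. y j)"
    using sum.group[of UNIV "{1..M}" blk "\<lambda>c. (x $ c) *\<^sub>R column c \<Phi>"] blk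
    by (auto simp: y_def image_subset_iff)
  finally have \<Phi>x: "\<Phi> *v x = (\<Sum>j=1..M. y j)" .
  have inv_nonneg: "0 \<le> y j \<bullet> ?inv j (y j)" if "j \<in> {1..M}" for j
    using closed_energy_inv_pos[OF that y[of j]] by (cases "y j = 0") auto
  have \<delta>: "0 \<le> ?\<delta>"
    using patch_condition_factor_nonneg[OF blk F] condition_factor_ge[OF blk] by (rule order_trans)
  have "x \<bullet> x = (\<Sum>j=1..M. y j \<bullet> y j)"
    using columns_isometry[of x] inner_patch_sums[of y y] y by (simp add: \<Phi>x)
  also have "\<dots> \<le> (\<Sum>j=1..M. ?\<delta> * (y j \<bullet> ?inv j (y j)))"
  proof (rule sum_mono)
    fix j assume j: "j \<in> {1..M}"
    have "y j \<bullet> y j \<le> ?\<delta>j j * (y j \<bullet> ?inv j (y j))"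
      by (rule patch_condition_factor_bound[OF j F yF])
    also have "\<dots> \<le> ?\<delta> * (y j \<bullet> ?inv j (y j))"
      by (rule mult_right_mono[OF condition_factor_ge[OF j] inv_nonneg[OF j]])
    finally show "y j \<bullet> y j \<le> ?\<delta> * (y j \<bullet> ?inv j (y j))" .
  qed
  also have "\<dots> = ?\<delta> * (\<Sum>j=1..M. y j \<bullet> ?inv j (y j))" by (simp add: sum_distrib_left)
  also have "\<dots> \<le> ?\<delta> * (x \<bullet> (gram *v x))"
    using closed_energy_inverses_le[of y] y \<delta> by (intro mult_left_mono) (simp_all add: gram_form \<Phi>x)
  finally show ?thesis .
qed

lemma spectral_bounds:
  shows "lambda_min A \<le> lambda_min (stiffness_matrix A \<Phi>)"
    and "lambda_max (stiffness_matrix A \<Phi>) \<le> condition_factor m E V M P \<Phi> blk"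
proof -
  let ?S = "stiffness_matrix A \<Phi>"
  let ?\<delta> = "condition_factor m E V M P \<Phi> blk"
  have S: "spd_matrix ?S" unfolding stiffness_eq_gram_inverse by (rule spd_inverse[OF gram_spd])
  have symS: "transpose ?S = ?S" and symA: "transpose A = A" and symG: "transpose gram = gram"
    using S spd gram_spd by (simp_all add: spd_matrix_def)
  have "lambda_max gram \<le> 1 / lambda_min A"
    using symmetric_lambda_max(1)[OF symG] gram_rayleigh_le by (rule eigenvalue_rayleigh_le)
  moreover have "lambda_max gram = 1 / lambda_min ?S"
    using spd_lambda_max_inverse[OF S] matrix_inv_matrix_inv[OF gram_spd]
    by (simp add: stiffness_eq_gram_inverse)
  moreover have "0 < lambda_min A" "0 < lambda_min ?S"
    using spd_eigenvalue_pos[OF spd symmetric_lambda_min(1)[OF symA]]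
      spd_eigenvalue_pos[OF S symmetric_lambda_min(1)[OF symS]] by blast+
  ultimately show "lambda_min A \<le> lambda_min ?S" by (simp add: field_simps)
  obtain x where x: "x \<noteq> 0" "gram *v x = lambda_min gram *\<^sub>R x"
    using symmetric_lambda_min(1)[OF symG] unfolding matrix_eigenvalue_def by blast
  have "x \<bullet> x \<le> (?\<delta> * lambda_min gram) * (x \<bullet> x)"
    using gram_rayleigh_ge[of x] by (simp add: x(2) mult.assoc)
  moreover have "0 < x \<bullet> x" using x(1) by simp
  ultimately have "1 \<le> ?\<delta> * lambda_min gram" by simp
  moreover have "0 < lambda_min gram"
    using spd_eigenvalue_pos[OF gram_spd symmetric_lambda_min(1)[OF symG]] .
  ultimately have "1 / lambda_min gram \<le> ?\<delta>" by (simp add: field_simps)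
  then show "lambda_max ?S \<le> ?\<delta>"
    by (simp add: stiffness_eq_gram_inverse spd_lambda_max_inverse[OF gram_spd])
qed

lemma condition_number_bounds:
  shows "condition_number (stiffness_matrix A \<Phi>) =
      lambda_max (stiffness_matrix A \<Phi>) / lambda_min (stiffness_matrix A \<Phi>)"
    and "lambda_max (stiffness_matrix A \<Phi>) / lambda_min (stiffness_matrix A \<Phi>)
      \<le> condition_factor m E V M P \<Phi> blk * spectral_norm (matrix_inv A)"
proof -
  let ?S = "stiffness_matrix A \<Phi>"
  have S: "spd_matrix ?S" unfolding stiffness_eq_gram_inverse by (rule spd_inverse[OF gram_spd])
  have sym: "transpose ?S = ?S" "transpose A = A"
    using S spd by (simp_all add: spd_matrix_def)
  show "condition_number ?S = lambda_max ?S / lambda_min ?S"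
    by (rule spd_condition_number[OF S])
  have pos: "0 < lambda_max ?S" "0 < lambda_min A"
    using spd_eigenvalue_pos[OF S symmetric_lambda_max(1)[OF sym(1)]]
      spd_eigenvalue_pos[OF spd symmetric_lambda_min(1)[OF sym(2)]] by blast+
  have "lambda_max ?S / lambda_min ?S \<le> condition_factor m E V M P \<Phi> blk / lambda_min A"
    using spectral_bounds pos by (intro frac_le) auto
  also have "1 / lambda_min A = spectral_norm (matrix_inv A)"
    by (simp add: psd_spectral_norm spd_imp_psd spd_inverse spd spd_lambda_max_inverse)
  then have "condition_factor m E V M P \<Phi> blk / lambda_min A =
      condition_factor m E V M P \<Phi> blk * spectral_norm (matrix_inv A)"
    by (metis divide_inverse inverse_eq_divide)
  finally show "lambda_max ?S / lambda_min ?S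
      \<le> condition_factor m E V M P \<Phi> blk * spectral_norm (matrix_inv A)" .
qed

end

theorem theorem3p22:
  fixes A :: "real^'n^'n"
    and E :: "nat \<Rightarrow> real^'n^'n" and m :: nat
    and V :: "(real^'n) set"
    and P :: "nat \<Rightarrow> (real^'n) set" and M :: nat
    and \<Phi> :: "real^'c^'n" and blk :: "'c \<Rightarrow> nat"
  assumes "spd_matrix A"
    and "energy_decomposition A m E"
    and "orthonormal_basis_on V (\<lambda>v. v) UNIV"
    and "indexed_partition V M P"
    and "\<forall>c. blk c \<in> {1..M}"
    and "\<forall>j\<in>{1..M}. \<exists>W. subspace W \<and> W \<subseteq> span (P j) \<and>
           orthonormal_basis_on {c. blk c = j} (\<lambda>c. column c \<Phi>) W"
  shows "lambda_min (stiffness_matrix A \<Phi>) \<ge> lambda_min A \<and>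
    lambda_max (stiffness_matrix A \<Phi>) \<le> condition_factor m E V M P \<Phi> blk \<and>
    condition_number (stiffness_matrix A \<Phi>) =
      lambda_max (stiffness_matrix A \<Phi>) / lambda_min (stiffness_matrix A \<Phi>) \<and>
    lambda_max (stiffness_matrix A \<Phi>) / lambda_min (stiffness_matrix A \<Phi>)
      \<le> condition_factor m E V M P \<Phi> blk * spectral_norm (matrix_inv A)"
proof -
  interpret patched_columns V A E m P M \<Phi> blk
    by unfold_locales (use assms in blast)+
  show ?thesis using spectral_bounds condition_number_bounds by blast
qed

end
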